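(* For all integers $m\geq 0$, \[ \sum_{\substack{k=0\\k\neq m}}^\infty\frac{\binom{2k}{k}}{4^k(2k-2m)} =\binom{2m}{m}\cdot\frac{\log 2-H_{2m}+H_m}{4^m}. \]
   Context: $H_n=\sum_{j=1}^n \frac1j$ denotes the $n$-th harmonic number ($H_0=0$; for $m=0$ the harmonic terms cancel in any case). *)

theory Defs
  imports "HOL-Analysis.Analysis"
begin

end

theory Submission
  imports Defs
begin

text \<open>
  Write $a_k = \binom{2k}{k}/4^k$ and $S_m$ for the sum in question. Since
  $(2k+2)\,a_{k+1} = (2k+1)\,a_k$, one has for $k \neq m$
  \[ (2m+1)\,\frac{a_k}{2k-2m} = (2m+2)\,\frac{a_{k+1}}{2(k+1)-2(m+1)} + (a_{k+1} - a_k), \]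
  and summation over $k$, using $a_k \to 0$, gives $(2m+2)\,S_{m+1} = (2m+1)\,S_m + a_{m+1} - a_m$,
  which the right-hand side satisfies too. For $m = 0$, integrating
  $\sum_k a_k x^k = (1-x)^{-1/2}$ gives
  $\sum_{k\ge1} a_k x^k/(2k) = -\ln\bigl((1+\sqrt{1-x})/2\bigr)$ on $[0,1)$; as all terms are
  nonnegative, one may let $x \to 1$.
\<close>

section \<open>The ratios a_k, their recurrence and their decay\<close>

definition central_ratio :: "nat \<Rightarrow> real" where
  "central_ratio k = real ((2 * k) choose k) / 4 ^ k"

lemma central_ratio_0 [simp]: "central_ratio 0 = 1"
  by (simp add: central_ratio_def)

lemma central_ratio_pos: "central_ratio k > 0"
  by (simp add: central_ratio_def)

lemma central_ratio_Suc:
  "(2 * real k + 2) * central_ratio (Suc k) = (2 * real k + 1) * central_ratio k"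
proof -
  have eq: "central_ratio j = fact (2 * j) / (fact j * fact j * 4 ^ j)" for j
    by (simp add: central_ratio_def binomial_fact mult_2)
  show ?thesis
    unfolding eq by (simp add: divide_simps) (simp add: algebra_simps)
qed

text \<open>Both sides are 1 at 0 and obey the recurrence of \<open>central_ratio_Suc\<close>, which
  for generalised binomial coefficients comes from \<open>gbinomial_mult_1\<close>. In this form the
  generating function is a binomial series with exponent -1/2.\<close>

lemma central_ratio_eq_gbinomial: "central_ratio k = ((- 1 / 2) gchoose k) * (- 1) ^ k"
proof (induction k)
  case (Suc k)
  have "(- 1 / 2) * ((- 1 / 2 :: real) gchoose k)
      = real k * ((- 1 / 2) gchoose k) + real (Suc k) * ((- 1 / 2) gchoose Suc k)"
    by (rule gbinomial_mult_1)
  then have step: "real (Suc k) * ((- 1 / 2) gchoose Suc k)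
      = - ((2 * real k + 1) / 2 * ((- 1 / 2 :: real) gchoose k))"
    by (simp add: field_simps)
  have "(2 * real k + 2) * (((- 1 / 2) gchoose Suc k) * (- 1) ^ Suc k)
      = - 2 * (- 1) ^ k * (real (Suc k) * ((- 1 / 2 :: real) gchoose Suc k))"
    by (simp add: algebra_simps)
  also have "\<dots> = (2 * real k + 1) * (((- 1 / 2 :: real) gchoose k) * (- 1) ^ k)"
    unfolding step by (simp add: field_simps)
  also have "\<dots> = (2 * real k + 2) * central_ratio (Suc k)"
    using central_ratio_Suc Suc.IH by simp
  finally have "(2 * real k + 2) * (((- 1 / 2) gchoose Suc k) * (- 1) ^ Suc k)
      = (2 * real k + 2) * central_ratio (Suc k)" .
  moreover have "2 * real k + 2 \<noteq> 0"
    by linarith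
  ultimately show ?case
    by (metis mult_left_cancel)
qed simp

text \<open>The weight 2k + 1 survives the induction because each step multiplies the left side by
  (2k+3)(2k+1)/(2k+2)^2, which is at most 1. The resulting decay of order 1/sqrt k sends the ratios
  to 0.\<close>

lemma central_ratio_sq_le: "(2 * real k + 1) * (central_ratio k)\<^sup>2 \<le> 1"
proof (induction k)
  case (Suc k)
  have eq: "central_ratio (Suc k) = (2 * real k + 1) / (2 * real k + 2) * central_ratio k"
    using central_ratio_Suc[of k] by (simp add: field_simps)
  have "(2 * real k + 3) * (2 * real k + 1) \<le> (2 * real k + 2)\<^sup>2"
    by (simp add: power2_eq_square algebra_simps)
  then have le1: "(2 * real k + 3) * (2 * real k + 1) / (2 * real k + 2)\<^sup>2 \<le> 1"
    by (intro divide_le_eq_1_pos[THEN iffD2] zero_less_power) auto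
  have "(2 * real (Suc k) + 1) * (central_ratio (Suc k))\<^sup>2
      = ((2 * real k + 3) * (2 * real k + 1) / (2 * real k + 2)\<^sup>2)
        * ((2 * real k + 1) * (central_ratio k)\<^sup>2)"
    unfolding eq by (simp add: power2_eq_square)
  also have "\<dots> \<le> 1 * 1"
    by (intro mult_mono Suc.IH le1) auto
  finally show ?case
    by simp
qed simp

lemma central_ratio_tendsto_0: "central_ratio \<longlonglongrightarrow> 0"
proof -
  have "(\<lambda>k. (central_ratio k)\<^sup>2) \<longlonglongrightarrow> 0"
  proof (rule tendsto_sandwich[of "\<lambda>_. 0" _ _ "\<lambda>k. 1 / real (Suc k)"])
    show "\<forall>\<^sub>F k in sequentially. (central_ratio k)\<^sup>2 \<le> 1 / real (Suc k)"
    proof (intro always_eventually allI)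
      fix k
      have "real (Suc k) * (central_ratio k)\<^sup>2 \<le> (2 * real k + 1) * (central_ratio k)\<^sup>2"
        by (intro mult_right_mono) auto
      with central_ratio_sq_le[of k] have "real (Suc k) * (central_ratio k)\<^sup>2 \<le> 1"
        by linarith
      then show "(central_ratio k)\<^sup>2 \<le> 1 / real (Suc k)"
        by (simp add: field_simps)
    qed
    show "(\<lambda>k. 1 / real (Suc k)) \<longlonglongrightarrow> 0"
      using LIMSEQ_inverse_real_of_nat by (simp add: inverse_eq_divide)
  qed auto
  from tendsto_real_sqrt[OF this] show ?thesis
    by (simp add: tendsto_rabs_zero_iff)
qed

section \<open>The generating function, its integral and the case m = 0\<close>

lemma central_ratio_powser:
  fixes x :: real
  assumes "\<bar>x\<bar> < 1"
  shows "(\<lambda>k. central_ratio k * x ^ k) sums (1 / sqrt (1 - x))"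
proof -
  have "(\<lambda>k. ((- 1 / 2) gchoose k) * (- x) ^ k) sums (1 + - x) powr (- 1 / 2)"
    using assms by (intro gen_binomial_real) simp
  also have "(\<lambda>k. ((- 1 / 2) gchoose k) * (- x) ^ k) = (\<lambda>k. central_ratio k * x ^ k)"
    by (simp add: central_ratio_eq_gbinomial fun_eq_iff power_minus[of x])
  also have "(1 + - x) powr (- 1 / 2) = 1 / sqrt (1 - x)"
    using assms powr_minus_divide[of "1 - x" "1 / 2"] by (simp add: powr_half_sqrt)
  finally show ?thesis .
qed

lemma central_ratio_powser_shift:
  fixes x :: real
  assumes "\<bar>x\<bar> < 1" "x \<noteq> 0"
  shows "(\<lambda>k. central_ratio (Suc k) * x ^ k) sums ((1 / sqrt (1 - x) - 1) / x)"
proof -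
  have "(\<lambda>k. central_ratio (Suc k) * x ^ Suc k) sums (1 / sqrt (1 - x) - 1)"
    using central_ratio_powser[OF assms(1)] by (subst sums_Suc_iff) simp
  from sums_divide[OF this, of x] show ?thesis
    using assms by simp
qed

text \<open>Both sides vanish at 0 and have the same derivative on (0, x): termwise, the series
  differentiates to half the series of \<open>central_ratio_powser_shift\<close>.\<close>

lemma central_ratio_powser_integrated:
  fixes x :: real
  assumes "0 \<le> x" "x < 1"
  shows "(\<lambda>k. central_ratio (Suc k) / (2 * real (Suc k)) * x ^ Suc k)
           sums (- ln ((1 + sqrt (1 - x)) / 2))"
proof -
  define c where "c k = central_ratio (Suc k) / (2 * real (Suc k))" for k
  define F where "F y = (\<Sum>k. c k * y ^ Suc k)" for y
  define g where "g y = - ln ((1 + sqrt (1 - y)) / 2)" for y :: real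
  have c_Suc: "c k * real (Suc k) * y ^ k = (central_ratio (Suc k) * y ^ k) / 2" for k y
    by (simp add: c_def field_simps)
  have smb: "summable (\<lambda>k. c k * real (Suc k) * y ^ k)" if "\<bar>y\<bar> < 1" for y
  \<comment> \<open>The closed form in \<open>central_ratio_powser_shift\<close> divides by y, so 0
    is treated apart.\<close>
  proof (cases "y = 0")
    case True
    then show ?thesis
      by (simp add: summable_zero_power')
  next
    case False
    show ?thesis
      unfolding c_Suc using central_ratio_powser_shift[OF that False]
      by (intro summable_divide) (rule sums_summable)
  qed
  have DF: "(F has_field_derivative (\<Sum>k. c k * real (Suc k) * y ^ k)) (at y)" if "\<bar>y\<bar> < 1" for y
    unfolding F_def using that by (intro DERIV_power_series'[where R = 1] smb) auto
  \<comment> \<open>The final \<open>sums\<close> needs convergence of the series itself, which the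
    derivative of \<open>F\<close> does not supply. Comparison with the generating series gives it,
    since 2(k + 1) \<ge> 1.\<close>
  have smF: "summable (\<lambda>k. c k * y ^ Suc k)" if "\<bar>y\<bar> < 1" for y
  proof (rule summable_comparison_test')
    show "summable (\<lambda>k. central_ratio (Suc k) * \<bar>y\<bar> ^ Suc k)"
      using central_ratio_powser[of "\<bar>y\<bar>"] that
      by (subst summable_Suc_iff) (auto intro: sums_summable)
    show "norm (c k * y ^ Suc k) \<le> central_ratio (Suc k) * \<bar>y\<bar> ^ Suc k" for k
    proof -
      have "\<bar>c k\<bar> \<le> central_ratio (Suc k)"
        using central_ratio_pos[of "Suc k"] mult_right_mono[of 1 "2 * real (Suc k)" "central_ratio (Suc k)"]
        by (simp add: c_def divide_simps abs_of_pos mult_ac)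
      then show ?thesis
        unfolding real_norm_def abs_mult power_abs by (intro mult_right_mono) auto
    qed
  qed
  have Dg: "(g has_field_derivative (1 / sqrt (1 - y) - 1) / y / 2) (at y)" if "0 < y" "y < 1" for y
  proof -
    \<comment> \<open>In terms of s, y factors as (1 - s)(1 + s), so (1/s - 1)/y collapses to 1/(s(1
      + s)).\<close>
    define s where "s = sqrt (1 - y)"
    have s: "0 < s" "s < 1" "y = 1 - s\<^sup>2"
      using that by (auto simp: s_def)
    have "((\<lambda>z. sqrt (1 - z)) has_field_derivative - 1 / (2 * s)) (at y)"
      using that by (auto intro!: derivative_eq_intros simp: s_def divide_simps)
    then have "((\<lambda>z. (1 + sqrt (1 - z)) / 2) has_field_derivative (0 + - 1 / (2 * s)) / 2) (at y)"
      by (intro DERIV_cdivide DERIV_add DERIV_const)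
    moreover have "0 < (1 + sqrt (1 - y)) / 2"
      using s(1) unfolding s_def[symmetric] by simp
    ultimately have "(g has_field_derivative
        - (1 / ((1 + sqrt (1 - y)) / 2) * ((0 + - 1 / (2 * s)) / 2))) (at y)"
      unfolding g_def by (intro DERIV_minus DERIV_chain2[OF DERIV_ln_divide])
    also have "- (1 / ((1 + sqrt (1 - y)) / 2) * ((0 + - 1 / (2 * s)) / 2)) = 1 / (2 * s * (1 + s))"
      using s(1) unfolding s_def[symmetric] by (simp add: divide_simps)
    also have "\<dots> = (1 / s - 1) / ((1 - s) * (1 + s)) / 2"
      using s(1,2) by (simp add: divide_simps)
    also have "(1 - s) * (1 + s) = y"
      using s(3) by (simp add: power2_eq_square algebra_simps)
    finally show ?thesis
      by (simp add: s_def)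
  qed
  have "F x - g x = F 0 - g 0"
  proof (cases "x = 0")
    case False
    with assms have x: "0 < x" by simp
    show ?thesis
    \<comment> \<open>Only the open interval needs the derivative, which avoids the division by y at
      0; continuity covers the endpoints.\<close>
    proof (rule DERIV_isconst2[OF x])
      show "continuous_on {0..x} (\<lambda>y. F y - g y)"
      proof (rule continuous_on_diff)
        show "continuous_on {0..x} F"
        proof (intro continuous_at_imp_continuous_on ballI)
          fix y assume "y \<in> {0..x}"
          with assms show "isCont F y"
            by (intro DERIV_isCont[OF DF]) auto
        qed
        show "continuous_on {0..x} g"
        proof -
          have "1 + sqrt (1 - y) \<noteq> 0" if "y \<in> {0..x}" for y
            using that assms add_pos_nonneg[of 1 "sqrt (1 - y)"] by auto
          then show ?thesis
            unfolding g_def by (intro continuous_intros) auto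
        qed
      qed
      show "DERIV (\<lambda>y. F y - g y) y :> 0" if "0 < y" "y < x" for y
      proof -
        have "(\<lambda>k. c k * real (Suc k) * y ^ k) sums ((1 / sqrt (1 - y) - 1) / y / 2)"
          unfolding c_Suc using that assms by (intro sums_divide central_ratio_powser_shift) auto
        with DF[of y] have "(F has_field_derivative (1 / sqrt (1 - y) - 1) / y / 2) (at y)"
          using that assms by (simp add: sums_iff)
        from DERIV_diff[OF this Dg[of y]] show ?thesis
          using that assms by simp
      qed
    qed (use x in auto)
  qed simp
  then have "F x = g x"
    by (simp add: F_def g_def)
  moreover have "(\<lambda>k. c k * x ^ Suc k) sums F x"
    unfolding F_def using assms by (intro summable_sums smF) auto
  ultimately show ?thesis
    by (simp only: c_def g_def)
qed

text \<open>Letting x tend to 1 in a fixed partial sum bounds it by ln 2, so the series converges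
  with sum at most ln 2. Conversely, x^(k+1) \<le> 1 on [0, 1) bounds \<open>g x\<close> by that
  sum, and x tending to 1 gives the other inequality.\<close>

lemma sums_central_ratio_over_even:
  "(\<lambda>k. central_ratio (Suc k) / (2 * real (Suc k))) sums ln 2"
proof -
  define c where "c k = central_ratio (Suc k) / (2 * real (Suc k))" for k
  define g where "g y = - ln ((1 + sqrt (1 - y)) / 2)" for y :: real
  have c_nonneg: "c k \<ge> 0" for k
    using central_ratio_pos[of "Suc k"] by (simp add: c_def)
  have Fg: "(\<lambda>k. c k * x ^ Suc k) sums g x" if "0 \<le> x" "x < 1" for x
    unfolding c_def g_def using that by (rule central_ratio_powser_integrated)
  have g1: "(g \<longlongrightarrow> ln 2) (at_left 1)"
  proof -
    have "(g \<longlongrightarrow> g 1) (at_left 1)"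
      unfolding g_def by (intro tendsto_intros) auto
    then show ?thesis
      by (simp add: g_def ln_div)
  qed
  have ev: "\<forall>\<^sub>F x in at_left 1. 0 \<le> x \<and> x < (1::real)"
    by (rule eventually_at_leftI[of 0]) auto
  have partial: "(\<Sum>k<n. c k) \<le> ln 2" for n
  proof (rule tendsto_le[OF _ g1])
    have "((\<lambda>x. \<Sum>k<n. c k * x ^ Suc k) \<longlongrightarrow> (\<Sum>k<n. c k * 1 ^ Suc k)) (at_left (1::real))"
      by (intro tendsto_intros)
    then show "((\<lambda>x. \<Sum>k<n. c k * x ^ Suc k) \<longlongrightarrow> (\<Sum>k<n. c k)) (at_left (1::real))"
      by simp
    show "\<forall>\<^sub>F x in at_left 1. (\<Sum>k<n. c k * x ^ Suc k) \<le> g x"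
      using ev
    proof eventually_elim
      case (elim x)
      then show ?case
        using Fg[of x] c_nonneg sum_le_suminf[of "\<lambda>k. c k * x ^ Suc k" "{..<n}"]
        by (simp add: sums_iff)
    qed
  qed simp
  have smb: "summable c"
    using c_nonneg partial by (rule summableI_nonneg_bounded)
  have "suminf c \<le> ln 2"
    using smb partial by (rule suminf_le_const)
  moreover have "ln 2 \<le> suminf c"
  proof (rule tendsto_upperbound[OF g1])
    show "\<forall>\<^sub>F x in at_left 1. g x \<le> suminf c"
      using ev
    proof eventually_elim
      case (elim x)
      have "c k * x ^ Suc k \<le> c k" for k
        using elim c_nonneg[of k] power_le_one[of x "Suc k"] by (intro mult_left_le) auto
      then show ?case
        using elim by (intro sums_le[OF _ Fg summable_sums[OF smb]]) auto
    qed
  qed simp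
  ultimately show ?thesis
    using smb by (simp add: c_def[abs_def] sums_iff)
qed

section \<open>The punctured series and the induction on m\<close>

definition punctured_term :: "nat \<Rightarrow> nat \<Rightarrow> real" where
  "punctured_term m k = (if k = m then 0 else central_ratio k / (2 * real k - 2 * real m))"

text \<open>Shifting both indices keeps the denominator 2k - 2m. Writing 2m + 2 = (2k + 2) - (2k -
  2m) and using the recurrence, (2m+2) a_{k+1} = (2m+1) a_k - (2k-2m)(a_{k+1} - a_k); then
  divide.\<close>

lemma punctured_term_Suc:
  assumes "k \<noteq> m"
  shows "(2 * real m + 2) * punctured_term (Suc m) (Suc k)
       = (2 * real m + 1) * punctured_term m k - (central_ratio (Suc k) - central_ratio k)"
proof -
  have eq: "central_ratio (Suc k) = (2 * real k + 1) / (2 * real k + 2) * central_ratio k"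
    using central_ratio_Suc[of k] by (simp add: field_simps)
  have "2 * real k - 2 * real m \<noteq> 0" "2 * real k + 2 \<noteq> 0"
    using assms by auto
  with assms show ?thesis
    unfolding punctured_term_def eq by (simp add: divide_simps) (simp add: algebra_simps)
qed

lemma sums_punctured_term_Suc:
  assumes "punctured_term m sums S"
  shows "punctured_term (Suc m) sums
           (((2 * real m + 1) * S + central_ratio (Suc m) - central_ratio m) / (2 * real m + 2))"
proof -
  define d where "d k = central_ratio (Suc k) - central_ratio k" for k
  have "d sums (0 - central_ratio 0)"
    unfolding d_def by (rule telescope_sums[OF central_ratio_tendsto_0])
  then have "(\<lambda>k. (2 * real m + 1) * punctured_term m k - d k) sums ((2 * real m + 1) * S + 1)"
    using sums_diff[OF sums_mult[OF assms, of "2 * real m + 1"], of d "- 1"] by simp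
  \<comment> \<open>At k = m both punctured terms are 0, so the identity of
    \<open>punctured_term_Suc\<close> is off by \<open>d m\<close> there; a one-term series restores
    it.\<close>
  from sums_add[OF this sums_single[of m d]]
  have "(\<lambda>k. (2 * real m + 1) * punctured_term m k - d k + (if k = m then d k else 0))
          sums ((2 * real m + 1) * S + 1 + d m)"
    by simp
  moreover have "(2 * real m + 1) * punctured_term m k - d k + (if k = m then d k else 0)
      = (2 * real m + 2) * punctured_term (Suc m) (Suc k)" for k
    using punctured_term_Suc[of k m] by (auto simp: d_def punctured_term_def)
  ultimately have "(\<lambda>k. (2 * real m + 2) * punctured_term (Suc m) (Suc k))
      sums ((2 * real m + 1) * S + 1 + d m)"
    by simp
  from sums_divide[OF this, of "2 * real m + 2"]
  have "(\<lambda>k. punctured_term (Suc m) (Suc k))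
      sums (((2 * real m + 1) * S + 1 + d m) / (2 * real m + 2))"
    by (simp add: add_nonneg_eq_0_iff)
  then have "punctured_term (Suc m)
      sums (((2 * real m + 1) * S + 1 + d m) / (2 * real m + 2) + punctured_term (Suc m) 0)"
    by (rule iffD1[OF sums_Suc_iff])
  \<comment> \<open>This is the term at index 0 that the shift left out; it cancels the 1 coming
    from the telescoping sum -a_0.\<close>
  also have "punctured_term (Suc m) 0 = - 1 / (2 * real m + 2)"
    by (simp add: punctured_term_def divide_simps)
  finally show ?thesis
    by (simp add: d_def diff_divide_distrib add_divide_distrib algebra_simps)
qed

lemma sums_punctured_term:
  "punctured_term m sums (central_ratio m * (ln 2 - harm (2 * m) + harm m))"
proof (induction m)
  case 0
  have "(\<lambda>k. punctured_term 0 (Suc k)) sums ln 2"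
    using sums_central_ratio_over_even by (simp add: punctured_term_def)
  from iffD1[OF sums_Suc_iff this] show ?case
    by (simp add: punctured_term_def harm_def)
next
  case (Suc m)
  have eq: "central_ratio (Suc m) = (2 * real m + 1) / (2 * real m + 2) * central_ratio m"
    using central_ratio_Suc[of m] by (simp add: field_simps)
  have harm2: "(harm (2 * Suc m) :: real)
      = harm (2 * m) + 1 / (2 * real m + 1) + 1 / (2 * real m + 2)"
    by (simp add: harm_Suc inverse_eq_divide add_ac)
  have harm1: "(harm (Suc m) :: real) = harm m + 2 / (2 * real m + 2)"
    by (simp add: harm_Suc field_simps)
  have nz: "2 * real m + 1 \<noteq> 0" "2 * real m + 2 \<noteq> 0"
    by linarith+
  \<comment> \<open>From m to m + 1, H_{2m} - H_m grows by 1/(2m+1) - 1/(2m+2). Times a_{m+1} this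
    is (a_m - a_{m+1})/(2m+2), exactly the inhomogeneous part of the recurrence with opposite
    sign.\<close>
  have "((2 * real m + 1) * (central_ratio m * (ln 2 - harm (2 * m) + harm m))
          + central_ratio (Suc m) - central_ratio m) / (2 * real m + 2)
      = central_ratio (Suc m) * (ln 2 - harm (2 * Suc m) + harm (Suc m))"
    unfolding eq harm2 harm1 using nz by (simp add: divide_simps) (simp add: algebra_simps)
  with sums_punctured_term_Suc[OF Suc.IH] show ?case
    by simp
qed

theorem theorem3p1:
  fixes m :: nat
  shows "(\<lambda>k::nat. if k = m then 0
            else real ((2 * k) choose k) / (4 ^ k * (2 * real k - 2 * real m)))
         sums (real ((2 * m) choose m) * ((ln 2 - harm (2 * m) + harm m) / 4 ^ m))"
  using sums_punctured_term[of m] by (simp add: punctured_term_def[abs_def] central_ratio_def cong: if_cong)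

end
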